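(* Let $t$ be a proof term of the system $\mathsf{LC}$ with $t : C$, and suppose $t \succ u$. Then $u : C$, and every free variable of $u$ is a free variable of $t$.
   Context: Formulas. Terms of the first-order language $\mathcal{L}$ are individual variables $\alpha,\beta,\dots$, constants, and $f(m_1,\dots,m_n)$ for function symbols $f$. Atomic formulas are $P(m_1,\dots,m_n)$ for predicate symbols $P$, including a $0$-ary symbol $\bot$; formulas are built from atomic ones with $\wedge,\vee,\to,\forall\alpha,\exists\alpha$. Proof terms of $\mathsf{LC}$ and typing (Church style; every proof variable $x^A$ carries its type; terms are taken up to renaming of bound variables). $x^A:A$. If $u:A$, $t:B$ then $\langle u,t\rangle:A\wedge B$; if $u:A\wedge B$ then $u\pi_0:A$ and $u\pi_1:B$. If $t:A\to B$, $u:A$ then $tu:B$; if $u:B$ then $\lambda x^A u:A\to B$. If $u:A$ then $\iota_0(u):A\vee B$; if $u:B$ then $\iota_1(u):A\vee B$; if $u:A\vee B$, $w_1:C$, $w_2:C$ then $u[x^A.w_1,y^B.w_2]:C$ (binding $x$ in $w_1$, $y$ in $w_2$). If $u:\forall\alpha A$ and $m$ is a term of $\mathcal L$ then $um:A[m/\alpha]$; if $u:A$ and $\alpha$ is not free in the type of any free proof variable of $u$ then $\lambda\alpha u:\forall\alpha A$. If $u:A[m/\alpha]$ then $(m,u):\exists\alpha A$; if $u:\exists\alpha A$ and $t:C$ with $\alpha$ not free in $C$ nor in the type of any free proof variable of $t$ other than $x^A$, then $u[(\alpha,x^A).t]:C$. Dummett rule: if $u:C$ and $v:C$, where the proof variable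 $a$ occurs in $u$ with type $A\to B$ and in $v$ with type $B\to A$, then $u\parallel_a v:C$, and $\parallel_a$ binds the free occurrences of $a$ in $u$ and $v$. If $u:\bot$ and $P$ is atomic then $\mathsf{efq}_P(u):P$. Stacks: a stack is a finite sequence $\sigma=\sigma_1\cdot\ldots\cdot\sigma_n$ where each $\sigma_i$ is a proof term, a term $m$ of $\mathcal L$, $\pi_0$ or $\pi_1$, $[x.u,y.v]$, or $[(\alpha,x).v]$; $\epsilon$ is the empty stack and $t\sigma$ denotes $((t\sigma_1)\sigma_2)\ldots\sigma_n$. A parallel context $\mathcal C[\,]$ is (omitting parentheses) an expression $u_1\parallel_{a_1}\cdots u_i\parallel_{a_i}[\,]\parallel_{a_{i+1}}u_{i+1}\cdots\parallel_{a_n}u_n$ with a hole $[\,]$; $\mathcal C[u]$ fills the hole with $u$. Basic reductions $\mapsto$: $(\lambda x u)t\mapsto u[t/x]$; $(\lambda\alpha u)m\mapsto u[m/\alpha]$; $\langle u_0,u_1\rangle\pi_i\mapsto u_i$; $\iota_i(u)[x_0.t_0,x_1.t_1]\mapsto t_i[u/x_i]$; $(m,u)[(\alpha,x).v]\mapsto v[m/\alpha][u/x]$; $(u\parallel_a v)w\mapsto uw\parallel_a vw$ ($a$ not free in $w$); $(u\parallel_a v)\pi_i\mapsto u\pi_i\parallel_a v\pi_i$; $(u\parallel_a v)[x.w_1,y.w_2]\mapsto u[x.w_1,y.w_2]\parallel_a v[x.w_1,y.w_2]$ ($a$ not free in $w_1,w_2$); $(u\parallel_a v)[(\alpha,x).w]\mapsto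 u[(\alpha,x).w]\parallel_a v[(\alpha,x).w]$ ($a$ not free in $w$); $\mathcal C[a^{A\to B}u\sigma]\parallel_a v\mapsto\mathcal C[v[\lambda y^B u/a^{B\to A}]]\parallel_a v$ and $v\parallel_a\mathcal C[a^{A\to B}u\sigma]\mapsto v\parallel_a\mathcal C[v[\lambda y^B u/a^{B\to A}]]$, for any parallel context $\mathcal C$, stack $\sigma$, with $a$ free in $\mathcal C[a u\sigma]$ and $y$ a dummy variable not occurring in $u$. Head reduction. Writing $t$ (without parentheses) as $t_1\parallel_{a_1}\cdots\parallel_{a_n}t_{n+1}$, each $t_i$ is a parallel process of $t$, called elementary if it is not of the form $u\parallel_a v$. A redex is a term $r$ with $r\mapsto r'$ for some $r'$. For a stack $\sigma$ and a stack $\xi$ of length one, the head redex of $t$ is: $(\lambda x u)v$ if $t=(\lambda xu)v\sigma$; $(\lambda\alpha u)m$ if $t=(\lambda\alpha u)m\sigma$; $\langle u,v\rangle\pi_i$ if $t=\langle u,v\rangle\pi_i\sigma$; $\iota_i(u)[x_1.t_1,x_2.t_2]$ if $t=\iota_i(u)[x_1.t_1,x_2.t_2]\sigma$; $(m,u)[(\alpha,x).v]$ if $t=(m,u)[(\alpha,x).v]\sigma$; $(u\parallel_a v)\xi$ if $t=(u\parallel_a v)\xi\sigma$; $t$ itself if $t=u\parallel_a v$ — in each case provided the indicated subterm is a redex. The starting symbol of a redex $r$ is its opening parenthesis if $r=(u\xi)$, and if $r=u\parallel_a v$ it is the leftmost occurrence of $a$ such that $a\,s\,\rho$ is an elementary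 process of $r$. $t\succ t'$ (head reduction) means $t'$ is obtained from $t$ by contracting, with a basic reduction, the head redex whose starting symbol is leftmost in $t$ among the head redexes of the parallel processes of $t$. *)

theory Defs
  imports Main
begin

text \<open>
  Individual variables and proof variables are two separate families of de Bruijn indices, so that
  terms differing only in the names of bound variables are equal. A binder of either kind binds
  index \<open>0\<close> of that kind, and the index \<open>Suc n\<close> below it is the variable \<open>n\<close> outside it.
\<close>

section \<open>The language and its formulas\<close>

text \<open>A language is given by its function and predicate symbols together with their arities;
  constants are 0-ary function symbols. The predicate \<open>Bot\<close> belongs to every language.\<close>

record ('f, 'p) language =
  funs :: "('f \<times> nat) set"
  preds :: "('p \<times> nat) set"

datatype 'f iterm = Var nat | Fun 'f "'f iterm list"

datatype ('f, 'p) form =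
    Pred 'p "'f iterm list"
  | Bot
  | And "('f, 'p) form" "('f, 'p) form"
  | Or "('f, 'p) form" "('f, 'p) form"
  | Imp "('f, 'p) form" "('f, 'p) form"
  | All "('f, 'p) form"
  | Ex "('f, 'p) form"

fun wf_iterm :: "('f, 'p) language \<Rightarrow> 'f iterm \<Rightarrow> bool" where
  "wf_iterm L (Var n) = True"
| "wf_iterm L (Fun f ms) = ((f, length ms) \<in> funs L \<and> (\<forall>m\<in>set ms. wf_iterm L m))"

fun wf_form :: "('f, 'p) language \<Rightarrow> ('f, 'p) form \<Rightarrow> bool" where
  "wf_form L (Pred P ms) = ((P, length ms) \<in> preds L \<and> (\<forall>m\<in>set ms. wf_iterm L m))"
| "wf_form L Bot = True"
| "wf_form L (And A B) = (wf_form L A \<and> wf_form L B)"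
| "wf_form L (Or A B) = (wf_form L A \<and> wf_form L B)"
| "wf_form L (Imp A B) = (wf_form L A \<and> wf_form L B)"
| "wf_form L (All A) = wf_form L A"
| "wf_form L (Ex A) = wf_form L A"

fun atomic :: "('f, 'p) form \<Rightarrow> bool" where
  "atomic (Pred P ms) = True"
| "atomic Bot = True"
| "atomic _ = False"

fun fiv_iterm :: "'f iterm \<Rightarrow> nat set" where
  "fiv_iterm (Var n) = {n}"
| "fiv_iterm (Fun f ms) = (\<Union>m\<in>set ms. fiv_iterm m)"

fun fiv_form :: "('f, 'p) form \<Rightarrow> nat set" where
  "fiv_form (Pred P ms) = (\<Union>m\<in>set ms. fiv_iterm m)"
| "fiv_form Bot = {}"
| "fiv_form (And A B) = fiv_form A \<union> fiv_form B"
| "fiv_form (Or A B) = fiv_form A \<union> fiv_form B"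
| "fiv_form (Imp A B) = fiv_form A \<union> fiv_form B"
| "fiv_form (All A) = {n. Suc n \<in> fiv_form A}"
| "fiv_form (Ex A) = {n. Suc n \<in> fiv_form A}"

text \<open>Simultaneous substitution for all free individual variables. The renaming \<open>shift\<close> moves an
  expression under one more individual binder; \<open>inst m\<close> replaces the variable bound by an
  outermost binder that is being removed, so \<open>subst_form (inst m) A\<close> is \<open>A[m/\<alpha>]\<close> for the body
  \<open>A\<close> of \<open>\<forall>\<alpha> A\<close>.\<close>

fun subst_iterm :: "(nat \<Rightarrow> 'f iterm) \<Rightarrow> 'f iterm \<Rightarrow> 'f iterm" where
  "subst_iterm s (Var n) = s n"
| "subst_iterm s (Fun f ms) = Fun f (map (subst_iterm s) ms)"

definition shift :: "nat \<Rightarrow> 'f iterm" where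
  "shift n = Var (Suc n)"

definition inst :: "'f iterm \<Rightarrow> nat \<Rightarrow> 'f iterm" where
  "inst m n = (case n of 0 \<Rightarrow> m | Suc k \<Rightarrow> Var k)"

definition up :: "(nat \<Rightarrow> 'f iterm) \<Rightarrow> nat \<Rightarrow> 'f iterm" where
  "up s n = (case n of 0 \<Rightarrow> Var 0 | Suc k \<Rightarrow> subst_iterm shift (s k))"

primrec subst_form :: "(nat \<Rightarrow> 'f iterm) \<Rightarrow> ('f, 'p) form \<Rightarrow> ('f, 'p) form" where
  "subst_form s (Pred P ms) = Pred P (map (subst_iterm s) ms)"
| "subst_form s Bot = Bot"
| "subst_form s (And A B) = And (subst_form s A) (subst_form s B)"
| "subst_form s (Or A B) = Or (subst_form s A) (subst_form s B)"
| "subst_form s (Imp A B) = Imp (subst_form s A) (subst_form s B)"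
| "subst_form s (All A) = All (subst_form (up s) A)"
| "subst_form s (Ex A) = Ex (subst_form (up s) A)"


section \<open>Proof terms\<close>

text \<open>
  Every occurrence \<open>PVar n A\<close> of a proof variable carries its type \<open>A\<close>. Scopes:
  \<^item> \<open>Lam A u\<close> is \<open>\<lambda>x\<^sup>A u\<close>;
  \<^item> \<open>Case u A v B w\<close> is \<open>u[x\<^sup>A.v, y\<^sup>B.w]\<close>;
  \<^item> \<open>ILam u\<close> is \<open>\<lambda>\<alpha> u\<close>, \<open>IApp u m\<close> is \<open>u m\<close> for an individual term \<open>m\<close>, and \<open>IPair m u\<close> is \<open>(m, u)\<close>;
  \<^item> \<open>ExE u A t\<close> is \<open>u[(\<alpha>, x\<^sup>A).t]\<close>: \<open>\<alpha>\<close> is the individual variable \<open>0\<close> of both \<open>A\<close> and \<open>t\<close>, and \<open>x\<close> is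
    the proof variable \<open>0\<close> of \<open>t\<close>;
  \<^item> \<open>Par u v\<close> is \<open>u \<parallel>\<^sub>a v\<close>: \<open>a\<close> is the proof variable \<open>0\<close> of both \<open>u\<close> and \<open>v\<close>.
\<close>

datatype ('f, 'p) pterm =
    PVar nat "('f, 'p) form"
  | Pair "('f, 'p) pterm" "('f, 'p) pterm"
  | Proj0 "('f, 'p) pterm"
  | Proj1 "('f, 'p) pterm"
  | Lam "('f, 'p) form" "('f, 'p) pterm"
  | App "('f, 'p) pterm" "('f, 'p) pterm"
  | Inj0 "('f, 'p) pterm"
  | Inj1 "('f, 'p) pterm"
  | Case "('f, 'p) pterm" "('f, 'p) form" "('f, 'p) pterm" "('f, 'p) form" "('f, 'p) pterm"
  | ILam "('f, 'p) pterm"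
  | IApp "('f, 'p) pterm" "'f iterm"
  | IPair "'f iterm" "('f, 'p) pterm"
  | ExE "('f, 'p) pterm" "('f, 'p) form" "('f, 'p) pterm"
  | Par "('f, 'p) pterm" "('f, 'p) pterm"
  | Efq "('f, 'p) form" "('f, 'p) pterm"

text \<open>Free proof variables, each together with its type. Below \<open>ILam\<close> and \<open>ExE\<close> the types live
  under one more individual binder, hence the \<open>shift\<close>; the typing rules exclude free proof variables
  whose type contains the individual variable bound there.\<close>

fun fpv :: "('f, 'p) pterm \<Rightarrow> (nat \<times> ('f, 'p) form) set" where
  "fpv (PVar n A) = {(n, A)}"
| "fpv (Pair u v) = fpv u \<union> fpv v"
| "fpv (Proj0 u) = fpv u"
| "fpv (Proj1 u) = fpv u"
| "fpv (Lam A u) = {(n, D). (Suc n, D) \<in> fpv u}"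
| "fpv (App u v) = fpv u \<union> fpv v"
| "fpv (Inj0 u) = fpv u"
| "fpv (Inj1 u) = fpv u"
| "fpv (Case u A v B w) =
     fpv u \<union> {(n, D). (Suc n, D) \<in> fpv v} \<union> {(n, D). (Suc n, D) \<in> fpv w}"
| "fpv (ILam u) = {(n, D). (n, subst_form shift D) \<in> fpv u}"
| "fpv (IApp u m) = fpv u"
| "fpv (IPair m u) = fpv u"
| "fpv (ExE u A t) = fpv u \<union> {(n, D). (Suc n, subst_form shift D) \<in> fpv t}"
| "fpv (Par u v) = {(n, D). (Suc n, D) \<in> fpv u} \<union> {(n, D). (Suc n, D) \<in> fpv v}"
| "fpv (Efq A u) = fpv u"

text \<open>Free individual variables, including those of the types written in the term.\<close>

fun fiv :: "('f, 'p) pterm \<Rightarrow> nat set" where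
  "fiv (PVar n A) = fiv_form A"
| "fiv (Pair u v) = fiv u \<union> fiv v"
| "fiv (Proj0 u) = fiv u"
| "fiv (Proj1 u) = fiv u"
| "fiv (Lam A u) = fiv_form A \<union> fiv u"
| "fiv (App u v) = fiv u \<union> fiv v"
| "fiv (Inj0 u) = fiv u"
| "fiv (Inj1 u) = fiv u"
| "fiv (Case u A v B w) = fiv u \<union> fiv_form A \<union> fiv v \<union> fiv_form B \<union> fiv w"
| "fiv (ILam u) = {n. Suc n \<in> fiv u}"
| "fiv (IApp u m) = fiv u \<union> fiv_iterm m"
| "fiv (IPair m u) = fiv_iterm m \<union> fiv u"
| "fiv (ExE u A t) = fiv u \<union> {n. Suc n \<in> fiv_form A \<union> fiv t}"
| "fiv (Par u v) = fiv u \<union> fiv v"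
| "fiv (Efq A u) = fiv_form A \<union> fiv u"

text \<open>
  The side condition \<open>\<forall>D. (0, D) \<in> fpv u \<longrightarrow> D = A\<close> says that the proof variable being bound
  occurs in \<open>u\<close>, if at all, with type \<open>A\<close>. The Dummett rule does not ask for an actual occurrence.
\<close>

inductive typing :: "('f, 'p) language \<Rightarrow> ('f, 'p) pterm \<Rightarrow> ('f, 'p) form \<Rightarrow> bool"
  ("_ \<turnstile> _ \<Ztypecolon> _" [51, 51, 51] 50) for L where
  t_var: "wf_form L A \<Longrightarrow> L \<turnstile> PVar n A \<Ztypecolon> A"
| t_pair: "L \<turnstile> u \<Ztypecolon> A \<Longrightarrow> L \<turnstile> t \<Ztypecolon> B \<Longrightarrow> L \<turnstile> Pair u t \<Ztypecolon> And A B"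
| t_proj0: "L \<turnstile> u \<Ztypecolon> And A B \<Longrightarrow> L \<turnstile> Proj0 u \<Ztypecolon> A"
| t_proj1: "L \<turnstile> u \<Ztypecolon> And A B \<Longrightarrow> L \<turnstile> Proj1 u \<Ztypecolon> B"
| t_app: "L \<turnstile> t \<Ztypecolon> Imp A B \<Longrightarrow> L \<turnstile> u \<Ztypecolon> A \<Longrightarrow> L \<turnstile> App t u \<Ztypecolon> B"
| t_lam: "wf_form L A \<Longrightarrow> L \<turnstile> u \<Ztypecolon> B \<Longrightarrow> (\<forall>D. (0, D) \<in> fpv u \<longrightarrow> D = A)
    \<Longrightarrow> L \<turnstile> Lam A u \<Ztypecolon> Imp A B"
| t_inj0: "wf_form L B \<Longrightarrow> L \<turnstile> u \<Ztypecolon> A \<Longrightarrow> L \<turnstile> Inj0 u \<Ztypecolon> Or A B"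
| t_inj1: "wf_form L A \<Longrightarrow> L \<turnstile> u \<Ztypecolon> B \<Longrightarrow> L \<turnstile> Inj1 u \<Ztypecolon> Or A B"
| t_case: "L \<turnstile> u \<Ztypecolon> Or A B
    \<Longrightarrow> L \<turnstile> v \<Ztypecolon> C \<Longrightarrow> (\<forall>D. (0, D) \<in> fpv v \<longrightarrow> D = A)
    \<Longrightarrow> L \<turnstile> w \<Ztypecolon> C \<Longrightarrow> (\<forall>D. (0, D) \<in> fpv w \<longrightarrow> D = B)
    \<Longrightarrow> L \<turnstile> Case u A v B w \<Ztypecolon> C"
| t_iapp: "L \<turnstile> u \<Ztypecolon> All A \<Longrightarrow> wf_iterm L m \<Longrightarrow> L \<turnstile> IApp u m \<Ztypecolon> subst_form (inst m) A"
| t_ilam: "L \<turnstile> u \<Ztypecolon> A \<Longrightarrow> (\<forall>n D. (n, D) \<in> fpv u \<longrightarrow> 0 \<notin> fiv_form D)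
    \<Longrightarrow> L \<turnstile> ILam u \<Ztypecolon> All A"
| t_ipair: "wf_form L A \<Longrightarrow> wf_iterm L m \<Longrightarrow> L \<turnstile> u \<Ztypecolon> subst_form (inst m) A
    \<Longrightarrow> L \<turnstile> IPair m u \<Ztypecolon> Ex A"
| t_exe: "L \<turnstile> u \<Ztypecolon> Ex A
    \<Longrightarrow> L \<turnstile> t \<Ztypecolon> subst_form shift C \<comment> \<open>so the bound \<open>\<alpha>\<close> is not free in the type of \<open>t\<close>\<close>
    \<Longrightarrow> (\<forall>D. (0, D) \<in> fpv t \<longrightarrow> D = A)
    \<Longrightarrow> (\<forall>n D. (Suc n, D) \<in> fpv t \<longrightarrow> 0 \<notin> fiv_form D)
    \<Longrightarrow> L \<turnstile> ExE u A t \<Ztypecolon> C"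
| t_dummett: "L \<turnstile> u \<Ztypecolon> C \<Longrightarrow> (\<forall>D. (0, D) \<in> fpv u \<longrightarrow> D = Imp A B)
    \<Longrightarrow> L \<turnstile> v \<Ztypecolon> C \<Longrightarrow> (\<forall>D. (0, D) \<in> fpv v \<longrightarrow> D = Imp B A)
    \<Longrightarrow> L \<turnstile> Par u v \<Ztypecolon> C"
| t_efq: "atomic P \<Longrightarrow> wf_form L P \<Longrightarrow> L \<turnstile> u \<Ztypecolon> Bot \<Longrightarrow> L \<turnstile> Efq P u \<Ztypecolon> P"


section \<open>Substitution in proof terms\<close>

text \<open>Individual terms for individual variables; this also acts on the types of proof variables.\<close>

primrec subst_ind :: "(nat \<Rightarrow> 'f iterm) \<Rightarrow> ('f, 'p) pterm \<Rightarrow> ('f, 'p) pterm" where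
  "subst_ind s (PVar n A) = PVar n (subst_form s A)"
| "subst_ind s (Pair u v) = Pair (subst_ind s u) (subst_ind s v)"
| "subst_ind s (Proj0 u) = Proj0 (subst_ind s u)"
| "subst_ind s (Proj1 u) = Proj1 (subst_ind s u)"
| "subst_ind s (Lam A u) = Lam (subst_form s A) (subst_ind s u)"
| "subst_ind s (App u v) = App (subst_ind s u) (subst_ind s v)"
| "subst_ind s (Inj0 u) = Inj0 (subst_ind s u)"
| "subst_ind s (Inj1 u) = Inj1 (subst_ind s u)"
| "subst_ind s (Case u A v B w) =
     Case (subst_ind s u) (subst_form s A) (subst_ind s v) (subst_form s B) (subst_ind s w)"
| "subst_ind s (ILam u) = ILam (subst_ind (up s) u)"
| "subst_ind s (IApp u m) = IApp (subst_ind s u) (subst_iterm s m)"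
| "subst_ind s (IPair m u) = IPair (subst_iterm s m) (subst_ind s u)"
| "subst_ind s (ExE u A t) = ExE (subst_ind s u) (subst_form (up s) A) (subst_ind (up s) t)"
| "subst_ind s (Par u v) = Par (subst_ind s u) (subst_ind s v)"
| "subst_ind s (Efq A u) = Efq (subst_form s A) (subst_ind s u)"

text \<open>\<open>lift d c t\<close> adds \<open>d\<close> to every free proof variable of \<open>t\<close> with index at least \<open>c\<close>.\<close>

primrec lift :: "nat \<Rightarrow> nat \<Rightarrow> ('f, 'p) pterm \<Rightarrow> ('f, 'p) pterm" where
  "lift d c (PVar n A) = PVar (if n < c then n else n + d) A"
| "lift d c (Pair u v) = Pair (lift d c u) (lift d c v)"
| "lift d c (Proj0 u) = Proj0 (lift d c u)"
| "lift d c (Proj1 u) = Proj1 (lift d c u)"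
| "lift d c (Lam A u) = Lam A (lift d (Suc c) u)"
| "lift d c (App u v) = App (lift d c u) (lift d c v)"
| "lift d c (Inj0 u) = Inj0 (lift d c u)"
| "lift d c (Inj1 u) = Inj1 (lift d c u)"
| "lift d c (Case u A v B w) = Case (lift d c u) A (lift d (Suc c) v) B (lift d (Suc c) w)"
| "lift d c (ILam u) = ILam (lift d c u)"
| "lift d c (IApp u m) = IApp (lift d c u) m"
| "lift d c (IPair m u) = IPair m (lift d c u)"
| "lift d c (ExE u A t) = ExE (lift d c u) A (lift d (Suc c) t)"
| "lift d c (Par u v) = Par (lift d (Suc c) u) (lift d (Suc c) v)"
| "lift d c (Efq A u) = Efq A (lift d c u)"

text \<open>\<open>subst_prf k t u\<close> replaces the proof variable \<open>k\<close> of \<open>u\<close> by \<open>t\<close> and lowers the larger indices,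
  the binder of \<open>k\<close> being removed. For the body \<open>u\<close> of \<open>\<lambda>x u\<close>, \<open>subst_prf 0 t u\<close> is \<open>u[t/x]\<close>.\<close>

primrec subst_prf :: "nat \<Rightarrow> ('f, 'p) pterm \<Rightarrow> ('f, 'p) pterm \<Rightarrow> ('f, 'p) pterm" where
  "subst_prf k t (PVar n A) =
     (if n < k then PVar n A else if n = k then t else PVar (n - 1) A)"
| "subst_prf k t (Pair u v) = Pair (subst_prf k t u) (subst_prf k t v)"
| "subst_prf k t (Proj0 u) = Proj0 (subst_prf k t u)"
| "subst_prf k t (Proj1 u) = Proj1 (subst_prf k t u)"
| "subst_prf k t (Lam A u) = Lam A (subst_prf (Suc k) (lift 1 0 t) u)"
| "subst_prf k t (App u v) = App (subst_prf k t u) (subst_prf k t v)"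
| "subst_prf k t (Inj0 u) = Inj0 (subst_prf k t u)"
| "subst_prf k t (Inj1 u) = Inj1 (subst_prf k t u)"
| "subst_prf k t (Case u A v B w) =
     Case (subst_prf k t u) A (subst_prf (Suc k) (lift 1 0 t) v) B (subst_prf (Suc k) (lift 1 0 t) w)"
| "subst_prf k t (ILam u) = ILam (subst_prf k (subst_ind shift t) u)"
| "subst_prf k t (IApp u m) = IApp (subst_prf k t u) m"
| "subst_prf k t (IPair m u) = IPair m (subst_prf k t u)"
| "subst_prf k t (ExE u A w) =
     ExE (subst_prf k t u) A (subst_prf (Suc k) (lift 1 0 (subst_ind shift t)) w)"
| "subst_prf k t (Par u v) = Par (subst_prf (Suc k) (lift 1 0 t) u) (subst_prf (Suc k) (lift 1 0 t) v)"
| "subst_prf k t (Efq A u) = Efq A (subst_prf k t u)"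


section \<open>Stacks and parallel contexts\<close>

text \<open>\<open>SCase A v B w\<close> is \<open>[x\<^sup>A.v, y\<^sup>B.w]\<close> and \<open>SEx A v\<close> is \<open>[(\<alpha>, x\<^sup>A).v]\<close>.\<close>

datatype ('f, 'p) selem =
    SPrf "('f, 'p) pterm"
  | SInd "'f iterm"
  | SProj0
  | SProj1
  | SCase "('f, 'p) form" "('f, 'p) pterm" "('f, 'p) form" "('f, 'p) pterm"
  | SEx "('f, 'p) form" "('f, 'p) pterm"

type_synonym ('f, 'p) stack = "('f, 'p) selem list"

fun elim :: "('f, 'p) pterm \<Rightarrow> ('f, 'p) selem \<Rightarrow> ('f, 'p) pterm" where
  "elim t (SPrf u) = App t u"
| "elim t (SInd m) = IApp t m"
| "elim t SProj0 = Proj0 t"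
| "elim t SProj1 = Proj1 t"
| "elim t (SCase A v B w) = Case t A v B w"
| "elim t (SEx A v) = ExE t A v"

definition elims :: "('f, 'p) pterm \<Rightarrow> ('f, 'p) stack \<Rightarrow> ('f, 'p) pterm"  (infixl "\<bullet>" 75) where
  "t \<bullet> \<sigma> = foldl elim t \<sigma>"

datatype ('f, 'p) pctx =
    Hole
  | ParL "('f, 'p) pctx" "('f, 'p) pterm"
  | ParR "('f, 'p) pterm" "('f, 'p) pctx"

fun fill :: "('f, 'p) pctx \<Rightarrow> ('f, 'p) pterm \<Rightarrow> ('f, 'p) pterm" where
  "fill Hole t = t"
| "fill (ParL C v) t = Par (fill C t) v"
| "fill (ParR u C) t = Par u (fill C t)"

text \<open>The number of binders \<open>\<parallel>\<^sub>a\<close> above the hole.\<close>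

fun depth :: "('f, 'p) pctx \<Rightarrow> nat" where
  "depth Hole = 0"
| "depth (ParL C v) = Suc (depth C)"
| "depth (ParR u C) = Suc (depth C)"


section \<open>Basic reductions\<close>

text \<open>
  In the two communication rules the variable \<open>depth C\<close> at the hole of \<open>C\<close> is the \<open>a\<close> bound
  by the displayed \<open>\<parallel>\<^sub>a\<close>. The term \<open>comm k B u v\<close> is \<open>v[\<lambda>y\<^sup>B u / a]\<close> as it has to be written at
  that hole, for \<open>k = depth C\<close>: the variables of \<open>v\<close> other than its own \<open>a\<close> are first moved past
  the \<open>k\<close> binders of \<open>C\<close> and the displayed one, whereas \<open>u\<close> already lives at the hole.
\<close>

definition comm :: "nat \<Rightarrow> ('f, 'p) form \<Rightarrow> ('f, 'p) pterm \<Rightarrow> ('f, 'p) pterm \<Rightarrow> ('f, 'p) pterm" where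
  "comm k B u v = subst_prf 0 (Lam B (lift 1 0 u)) (lift (Suc k) 1 v)"

inductive basic :: "('f, 'p) pterm \<Rightarrow> ('f, 'p) pterm \<Rightarrow> bool"  (infix "\<mapsto>" 50) where
  b_beta: "App (Lam A u) t \<mapsto> subst_prf 0 t u"
| b_ibeta: "IApp (ILam u) m \<mapsto> subst_ind (inst m) u"
| b_proj0: "Proj0 (Pair u v) \<mapsto> u"
| b_proj1: "Proj1 (Pair u v) \<mapsto> v"
| b_case0: "Case (Inj0 u) A v B w \<mapsto> subst_prf 0 u v"
| b_case1: "Case (Inj1 u) A v B w \<mapsto> subst_prf 0 u w"
| b_exe: "ExE (IPair m u) A v \<mapsto> subst_prf 0 u (subst_ind (inst m) v)"
| b_par_app: "App (Par u v) w \<mapsto> Par (App u (lift 1 0 w)) (App v (lift 1 0 w))"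
| b_par_iapp: "IApp (Par u v) m \<mapsto> Par (IApp u m) (IApp v m)"
| b_par_proj0: "Proj0 (Par u v) \<mapsto> Par (Proj0 u) (Proj0 v)"
| b_par_proj1: "Proj1 (Par u v) \<mapsto> Par (Proj1 u) (Proj1 v)"
| b_par_case: "Case (Par u v) A w1 B w2 \<mapsto>
    Par (Case u A (lift 1 1 w1) B (lift 1 1 w2)) (Case v A (lift 1 1 w1) B (lift 1 1 w2))"
| b_par_exe: "ExE (Par u v) A w \<mapsto> Par (ExE u A (lift 1 1 w)) (ExE v A (lift 1 1 w))"
| b_comm_left: "Par (fill C (App (PVar (depth C) (Imp A B)) u \<bullet> \<sigma>)) v \<mapsto>
    Par (fill C (comm (depth C) B u v)) v"
| b_comm_right: "Par v (fill C (App (PVar (depth C) (Imp A B)) u \<bullet> \<sigma>)) \<mapsto>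
    Par v (fill C (comm (depth C) B u v))"

definition redex :: "('f, 'p) pterm \<Rightarrow> bool" where
  "redex r \<longleftrightarrow> (\<exists>r'. r \<mapsto> r')"


section \<open>Head reduction\<close>

text \<open>\<open>head_redex t r \<sigma>\<close>: the term \<open>t\<close> is \<open>r \<bullet> \<sigma>\<close> and \<open>r\<close> is its head redex.\<close>

inductive head_redex :: "('f, 'p) pterm \<Rightarrow> ('f, 'p) pterm \<Rightarrow> ('f, 'p) stack \<Rightarrow> bool" where
  "r = App (Lam A u) v \<Longrightarrow> redex r \<Longrightarrow> head_redex (r \<bullet> \<sigma>) r \<sigma>"
| "r = IApp (ILam u) m \<Longrightarrow> redex r \<Longrightarrow> head_redex (r \<bullet> \<sigma>) r \<sigma>"
| "r = Proj0 (Pair u v) \<Longrightarrow> redex r \<Longrightarrow> head_redex (r \<bullet> \<sigma>) r \<sigma>"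
| "r = Proj1 (Pair u v) \<Longrightarrow> redex r \<Longrightarrow> head_redex (r \<bullet> \<sigma>) r \<sigma>"
| "r = Case (Inj0 u) A v B w \<Longrightarrow> redex r \<Longrightarrow> head_redex (r \<bullet> \<sigma>) r \<sigma>"
| "r = Case (Inj1 u) A v B w \<Longrightarrow> redex r \<Longrightarrow> head_redex (r \<bullet> \<sigma>) r \<sigma>"
| "r = ExE (IPair m u) A v \<Longrightarrow> redex r \<Longrightarrow> head_redex (r \<bullet> \<sigma>) r \<sigma>"
| "r = elim (Par u v) \<xi> \<Longrightarrow> redex r \<Longrightarrow> head_redex (r \<bullet> \<sigma>) r \<sigma>"
| "r = Par u v \<Longrightarrow> redex r \<Longrightarrow> head_redex r r []"

text \<open>
  The parallel processes of \<open>t\<close> are the \<open>p\<close> with \<open>t = fill D p\<close>, identified by their context \<open>D\<close>.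
  Positions of starting symbols are recorded only up to the elementary process containing them:
  \<open>position D\<close> is the number of elementary processes to the left of the hole of \<open>D\<close>. This suffices
  to order the starting symbols, because two different head redexes of parallel processes of \<open>t\<close>
  never start in the same elementary process: one of the form \<open>r \<bullet> \<sigma>\<close> with \<open>r\<close> not parallel
  contains only the opening parenthesis of \<open>r\<close>, and one of the form \<open>a s \<rho>\<close> contains at most the
  starting symbol of the one parallel composition that binds \<open>a\<close>.
\<close>

fun num_elementary :: "('f, 'p) pterm \<Rightarrow> nat" where
  "num_elementary (Par u v) = num_elementary u + num_elementary v"
| "num_elementary _ = 1"

fun position :: "('f, 'p) pctx \<Rightarrow> nat" where
  "position Hole = 0"
| "position (ParL C v) = position C"
| "position (ParR u C) = num_elementary u + position C"

text \<open>Within \<open>u \<parallel>\<^sub>a v\<close>, the index of \<open>a\<close> in a process with context \<open>D\<close> is \<open>depth D - 1\<close>.\<close>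

fun start :: "('f, 'p) pterm \<Rightarrow> nat" where
  "start (Par u v) = (LEAST i. \<exists>D n A s \<rho>.
     Par u v = fill D (App (PVar n A) s \<bullet> \<rho>) \<and> depth D = Suc n \<and> position D = i)"
| "start _ = 0"

definition head_red :: "('f, 'p) pterm \<Rightarrow> ('f, 'p) pterm \<Rightarrow> bool"  (infix "\<succ>" 50) where
  "t \<succ> t' \<longleftrightarrow> (\<exists>D p r \<sigma> r'.
     t = fill D p \<and> head_redex p r \<sigma> \<and>
     (\<forall>D2 p2 r2 \<sigma>2. t = fill D2 p2 \<and> head_redex p2 r2 \<sigma>2
        \<longrightarrow> position D + start r \<le> position D2 + start r2) \<and>
     r \<mapsto> r' \<and> t' = fill D (r' \<bullet> \<sigma>))"

end

theory Submission
  imports Defs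
begin

text \<open>
  Head reduction contracts one redex below eliminations and parallel compositions only, so it
  suffices that a basic reduction preserves the type and creates no free variable; the free proof
  variables also control the side conditions of the binders \<open>\<parallel>\<^sub>a\<close> around the redex. In a
  communication, \<open>a\<close> has type \<open>A \<rightarrow> B\<close> on one side and \<open>B \<rightarrow> A\<close> on the other, so the message
  \<open>\<lambda>y\<^sup>B u\<close> has the type of the variable it replaces. The only variables of the new process that can
  be bound around it come from \<open>u\<close>, which already occurred there.
\<close>

section \<open>Individual terms and formulas\<close>

lemma subst_iterm_cong:
  "(\<And>n. n \<in> fiv_iterm m \<Longrightarrow> s n = r n) \<Longrightarrow> subst_iterm s m = subst_iterm r m"
  by (induction m) auto

lemma subst_iterm_comp:
  "subst_iterm s (subst_iterm r m) = subst_iterm (\<lambda>n. subst_iterm s (r n)) m"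
  by (induction m) auto

lemma subst_iterm_Var: "subst_iterm Var m = m"
  by (induction m) (auto simp: map_idI)

lemma fiv_iterm_subst: "fiv_iterm (subst_iterm s m) = (\<Union>n\<in>fiv_iterm m. fiv_iterm (s n))"
  by (induction m) auto

lemma wf_iterm_subst:
  "wf_iterm L m \<Longrightarrow> (\<And>n. wf_iterm L (s n)) \<Longrightarrow> wf_iterm L (subst_iterm s m)"
  by (induction m) auto

lemma wf_iterm_shift: "wf_iterm L (shift n)"
  by (simp add: shift_def)

lemma wf_iterm_inst: "wf_iterm L m \<Longrightarrow> wf_iterm L (inst m n)"
  by (simp add: inst_def split: nat.split)

lemma wf_iterm_up: "(\<And>n. wf_iterm L (s n)) \<Longrightarrow> wf_iterm L (up s n)"
  by (simp add: up_def wf_iterm_subst wf_iterm_shift split: nat.split)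

text \<open>This is the binder case of \<open>subst_form_comp\<close>: applying \<open>up s\<close>
  after \<open>shift\<close> agrees with applying \<open>shift\<close> after
  \<open>s\<close>.\<close>

lemma up_comp: "subst_iterm (up s) (up r n) = up (\<lambda>n. subst_iterm s (r n)) n"
proof (cases n)
  case (Suc k)
  have "(\<lambda>j. subst_iterm (up s) (shift j)) = (\<lambda>j. subst_iterm shift (s j))"
    by (simp add: shift_def up_def)
  then show ?thesis by (simp add: Suc up_def subst_iterm_comp)
qed (simp add: up_def)

lemma up_Var: "up Var = Var"
  by (rule ext) (simp add: up_def shift_def split: nat.split)

lemma Suc_in_fiv_up: "Suc n \<in> fiv_iterm (up s j) \<longleftrightarrow> (\<exists>i. j = Suc i \<and> n \<in> fiv_iterm (s i))"
  by (cases j) (auto simp: up_def fiv_iterm_subst shift_def)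

lemma zero_in_fiv_up: "0 \<in> fiv_iterm (up s j) \<longleftrightarrow> j = 0"
  by (cases j) (auto simp: up_def fiv_iterm_subst shift_def)

section \<open>Substitution into formulas\<close>

lemma subst_form_cong:
  "(\<And>n. n \<in> fiv_form A \<Longrightarrow> s n = r n) \<Longrightarrow> subst_form s A = subst_form r A"
proof (induction A arbitrary: s r)
  case (Pred P ms)
  then show ?case by (auto intro!: subst_iterm_cong)
next
  case (All A)
  have "subst_form (up s) A = subst_form (up r) A"
    by (rule All.IH) (use All.prems in \<open>auto simp: up_def split: nat.split\<close>)
  then show ?case by simp
next
  case (Ex A)
  have "subst_form (up s) A = subst_form (up r) A"
    by (rule Ex.IH) (use Ex.prems in \<open>auto simp: up_def split: nat.split\<close>)
  then show ?case by simp
next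
  case (And A B)
  from And.IH[of s r] And.prems show ?case by simp
next
  case (Or A B)
  from Or.IH[of s r] Or.prems show ?case by simp
next
  case (Imp A B)
  from Imp.IH[of s r] Imp.prems show ?case by simp
qed auto

lemma subst_form_comp:
  "subst_form s (subst_form r A) = subst_form (\<lambda>n. subst_iterm s (r n)) A"
  by (induction A arbitrary: s r) (auto simp: subst_iterm_comp up_comp)

lemma subst_form_Var: "subst_form Var A = A"
  by (induction A) (auto simp: subst_iterm_Var up_Var map_idI)

lemma fiv_form_subst: "fiv_form (subst_form s A) = (\<Union>n\<in>fiv_form A. fiv_iterm (s n))"
  by (induction A arbitrary: s) (auto simp: fiv_iterm_subst Suc_in_fiv_up)

lemma wf_form_subst:
  "wf_form L A \<Longrightarrow> (\<And>n. wf_iterm L (s n)) \<Longrightarrow> wf_form L (subst_form s A)"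
  by (induction A arbitrary: s) (auto intro: wf_iterm_subst wf_iterm_up)

lemma atomic_subst: "atomic A \<Longrightarrow> atomic (subst_form s A)"
  by (cases A) auto

text \<open>\<open>inst m\<close> after \<open>shift\<close> is the identity substitution
  \<open>Var\<close>; hence \<open>shift\<close> is injective on formulas and a shifted type can be
  read back.\<close>

lemma subst_form_inst_shift [simp]: "subst_form (inst m) (subst_form shift A) = A"
proof -
  have "(\<lambda>n. subst_iterm (inst m) (shift n)) = Var"
    by (simp add: inst_def shift_def)
  then show ?thesis by (simp add: subst_form_comp subst_form_Var)
qed

lemma subst_form_shift_inject [simp]: "subst_form shift A = subst_form shift B \<longleftrightarrow> A = B"
  by (metis subst_form_inst_shift)

lemma subst_form_up_shift: "subst_form (up s) (subst_form shift A) = subst_form shift (subst_form s A)"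
  by (simp add: subst_form_comp) (simp add: shift_def up_def)

lemma subst_iterm_inst_shift: "subst_iterm (inst m) (subst_iterm shift k) = k"
proof -
  have "(\<lambda>n. subst_iterm (inst m) (shift n)) = Var"
    by (simp add: inst_def shift_def)
  then show ?thesis by (simp add: subst_iterm_comp subst_iterm_Var)
qed

text \<open>The substitution lemma for instances \<open>A[m/\<alpha>]\<close>; it makes
  \<open>t_iapp\<close> and \<open>t_ipair\<close> stable under individual substitution.\<close>

lemma subst_form_inst_commute:
  "subst_form s (subst_form (inst m) A) = subst_form (inst (subst_iterm s m)) (subst_form (up s) A)"
proof -
  have "(\<lambda>n. subst_iterm s (inst m n)) = (\<lambda>n. subst_iterm (inst (subst_iterm s m)) (up s n))"
    by (rule ext) (simp add: inst_def[of m] up_def subst_iterm_inst_shift inst_def[of _ 0] split: nat.split)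
  then show ?thesis by (simp add: subst_form_comp)
qed

lemma zero_notin_fiv_shift [simp]: "0 \<notin> fiv_form (subst_form shift A)"
  by (simp add: fiv_form_subst shift_def)

lemma zero_in_fiv_form_up: "0 \<in> fiv_form (subst_form (up s) A) \<longleftrightarrow> 0 \<in> fiv_form A"
  by (simp add: fiv_form_subst zero_in_fiv_up)

text \<open>Turns an eigenvariable condition into a preimage under \<open>shift\<close>, the form in
  which \<open>fpv\<close> records types found below an individual binder.\<close>

lemma zero_notin_fivE:
  assumes "0 \<notin> fiv_form A"
  obtains A' where "A = subst_form shift A'"
proof
  \<comment> \<open>\<open>inst (Var 0)\<close> followed by \<open>shift\<close> fixes every index
    except 0, which does not occur in \<open>A\<close>; the term \<open>Var 0\<close> is an
    arbitrary filler.\<close>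
  have "subst_form Var A = subst_form (\<lambda>n. subst_iterm shift (inst (Var 0) n)) A"
    by (rule subst_form_cong) (use assms in \<open>auto simp: inst_def shift_def intro: gr0I split: nat.split\<close>)
  then show "A = subst_form shift (subst_form (inst (Var 0)) A)"
    by (simp add: subst_form_comp subst_form_Var)
qed


section \<open>Free variables under substitution\<close>

text \<open>Lifting leaves a gap of \<open>d\<close> indices at \<open>c\<close>. In particular
  index 0 is absent after \<open>lift 1 0\<close>, so a binder put above the lifted term captures
  nothing in it.\<close>

lemma fpv_lift:
  "(n, D) \<in> fpv (lift d c u) \<longleftrightarrow>
     (if n < c then (n, D) \<in> fpv u else c + d \<le> n \<and> (n - d, D) \<in> fpv u)"
  by (induction u arbitrary: n c D) (auto simp: Suc_diff_le split: if_splits)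

text \<open>The inclusion may be strict for ill-typed terms: a variable of \<open>ILam u\<close> whose type contains
  the bound individual variable is not counted by \<open>fpv\<close>.\<close>

lemma fpv_subst_ind:
  "(n, D) \<in> fpv (subst_ind s u) \<Longrightarrow> \<exists>E. D = subst_form s E \<and> (n, E) \<in> fpv u"
proof (induction u arbitrary: n D s)
  case (ILam u)
  then obtain E where E: "subst_form shift D = subst_form (up s) E" "(n, E) \<in> fpv u"
    by fastforce
  \<comment> \<open>\<open>up s\<close> keeps index 0 and introduces it nowhere else. As its result
    here is a shifted formula, \<open>E\<close> is a shifted formula as well.\<close>
  then have "0 \<notin> fiv_form E"
    by (metis zero_in_fiv_form_up zero_notin_fiv_shift)
  then obtain E' where "E = subst_form shift E'" by (rule zero_notin_fivE)
  with E show ?case by (auto simp: subst_form_up_shift)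
next
  case (ExE u A t)
  show ?case
  proof (cases "(n, D) \<in> fpv (subst_ind s u)")
    case True
    with ExE.IH show ?thesis by fastforce
  next
    case False
    with ExE.prems have "(Suc n, subst_form shift D) \<in> fpv (subst_ind (up s) t)" by simp
    with ExE.IH(2) obtain E
      where E: "subst_form shift D = subst_form (up s) E" "(Suc n, E) \<in> fpv t"
      by blast
    then have "0 \<notin> fiv_form E"
      by (metis zero_in_fiv_form_up zero_notin_fiv_shift)
    then obtain E' where "E = subst_form shift E'" by (rule zero_notin_fivE)
    with E show ?thesis by (auto simp: subst_form_up_shift)
  qed
qed (simp; blast)+

lemma fpv_subst_ind_shift: "(n, subst_form shift D) \<in> fpv (subst_ind shift u) \<Longrightarrow> (n, D) \<in> fpv u"
  by (auto dest: fpv_subst_ind)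

text \<open>The binder of \<open>k\<close> disappears, so an index from \<open>k\<close> upwards
  stood one higher in \<open>u\<close>. The index taken in \<open>u\<close> is never
  \<open>k\<close>: that variable has been replaced by \<open>t\<close>.\<close>

lemma fpv_subst_prf:
  "(n, D) \<in> fpv (subst_prf k t u) \<Longrightarrow>
     (n, D) \<in> fpv t \<or> ((if n < k then n else Suc n), D) \<in> fpv u"
proof (induction u arbitrary: n D k t)
  case (PVar m A)
  then show ?case by (auto split: if_splits)
next
  case (Lam A u)
  from Lam.prems Lam.IH[of "Suc n" D "Suc k" "lift 1 0 t"] show ?case
    by (simp add: fpv_lift split: if_splits)
next
  case (Case u A v B w)
  from Case.prems Case.IH(1)[of n D k t] Case.IH(2,3)[of "Suc n" D "Suc k" "lift 1 0 t"]
  show ?case by (auto simp: fpv_lift split: if_splits)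
next
  case (Par u v)
  from Par.prems Par.IH[of "Suc n" D "Suc k" "lift 1 0 t"] show ?case
    by (auto simp: fpv_lift split: if_splits)
next
  case (ILam u)
  from ILam.prems ILam.IH[of n "subst_form shift D" k "subst_ind shift t"] show ?case
    by (auto dest: fpv_subst_ind_shift split: if_splits)
next
  case (ExE u A w)
  from ExE.prems ExE.IH(1)[of n D k t]
    ExE.IH(2)[of "Suc n" "subst_form shift D" "Suc k" "lift 1 0 (subst_ind shift t)"]
  show ?case by (auto simp: fpv_lift dest: fpv_subst_ind_shift split: if_splits)
qed (simp split del: if_split; blast)+

lemma fiv_lift [simp]: "fiv (lift d c u) = fiv u"
  by (induction u arbitrary: c) auto

lemma fiv_subst_ind: "fiv (subst_ind s u) = (\<Union>n\<in>fiv u. fiv_iterm (s n))"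
  by (induction u arbitrary: s) (auto simp: fiv_form_subst fiv_iterm_subst Suc_in_fiv_up)

lemma fiv_subst_ind_shift: "fiv (subst_ind shift u) = Suc ` fiv u"
  by (auto simp: fiv_subst_ind shift_def)

lemma fiv_subst_ind_inst: "fiv (subst_ind (inst m) u) \<subseteq> {n. Suc n \<in> fiv u} \<union> fiv_iterm m"
  by (auto simp: fiv_subst_ind inst_def split: nat.splits)

text \<open>Below \<open>ILam\<close> and \<open>ExE\<close> the term \<open>t\<close> is shifted,
  which maps its free variables by \<open>Suc\<close>; leaving the binder takes them back.\<close>

lemma fiv_subst_prf: "fiv (subst_prf k t u) \<subseteq> fiv t \<union> fiv u"
proof (induction u arbitrary: k t)
  case (ILam u)
  from ILam[of k "subst_ind shift t"] show ?case by (auto simp: fiv_subst_ind_shift)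
next
  case (ExE u A w)
  from ExE(1)[of k t] ExE(2)[of "Suc k" "lift 1 0 (subst_ind shift t)"] show ?case
    by (auto simp: fiv_subst_ind_shift)
next
  case (Lam A u)
  from Lam[of "Suc k" "lift 1 0 t"] show ?case by auto
next
  case (Case u A v B w)
  from Case(1)[of k t] Case(2,3)[of "Suc k" "lift 1 0 t"] show ?case by auto
next
  case (Par u v)
  from Par[of "Suc k" "lift 1 0 t"] show ?case by auto
qed (simp; blast)+


section \<open>Typing under substitution\<close>

inductive_cases typing_PVarE: "L \<turnstile> PVar n A \<Ztypecolon> C"
inductive_cases typing_PairE: "L \<turnstile> Pair u v \<Ztypecolon> C"
inductive_cases typing_Proj0E: "L \<turnstile> Proj0 u \<Ztypecolon> C"
inductive_cases typing_Proj1E: "L \<turnstile> Proj1 u \<Ztypecolon> C"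
inductive_cases typing_LamE: "L \<turnstile> Lam A u \<Ztypecolon> C"
inductive_cases typing_AppE: "L \<turnstile> App u v \<Ztypecolon> C"
inductive_cases typing_Inj0E: "L \<turnstile> Inj0 u \<Ztypecolon> C"
inductive_cases typing_Inj1E: "L \<turnstile> Inj1 u \<Ztypecolon> C"
inductive_cases typing_CaseE: "L \<turnstile> Case u A v B w \<Ztypecolon> C"
inductive_cases typing_ILamE: "L \<turnstile> ILam u \<Ztypecolon> C"
inductive_cases typing_IAppE: "L \<turnstile> IApp u m \<Ztypecolon> C"
inductive_cases typing_IPairE: "L \<turnstile> IPair m u \<Ztypecolon> C"
inductive_cases typing_ExEE: "L \<turnstile> ExE u A t \<Ztypecolon> C"
inductive_cases typing_ParE: "L \<turnstile> Par u v \<Ztypecolon> C"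

lemmas typing_elims = typing_PairE typing_Proj0E typing_Proj1E typing_LamE typing_AppE
  typing_Inj0E typing_Inj1E typing_CaseE typing_ILamE typing_IAppE typing_IPairE typing_ExEE
  typing_ParE

text \<open>Lifting renumbers proof variables without touching their types, so the eigenvariable
  conditions carry over.\<close>

lemma typing_lift: "L \<turnstile> u \<Ztypecolon> C \<Longrightarrow> L \<turnstile> lift d c u \<Ztypecolon> C"
proof (induction arbitrary: c rule: typing.induct)
  case (t_exe u A t C)
  show ?case
    unfolding lift.simps
    \<comment> \<open>For the last side condition, an index \<open>Suc n\<close> beyond the gap
      satisfies \<open>Suc c + d \<le> Suc n\<close>, so \<open>Suc n - d\<close> is again a
      successor.\<close>
    by (rule typing.t_exe) (use t_exe in \<open>auto simp: fpv_lift split: if_splits\<close>,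
      metis Suc_diff_le Suc_le_D add_leE not_less_eq_eq)
next
  case (t_ilam u A)
  show ?case
    unfolding lift.simps
    by (rule typing.t_ilam) (use t_ilam in \<open>auto simp: fpv_lift split: if_splits\<close>)
qed (auto intro!: typing.intros simp: fpv_lift intro: typing.intros)

text \<open>By \<open>fpv_subst_ind\<close>, every type of a free proof variable afterwards is the
  image of one before, which transports the side conditions; \<open>up s\<close> neither creates nor
  removes index 0, which transports the eigenvariable conditions.\<close>

lemma typing_subst_ind:
  "L \<turnstile> u \<Ztypecolon> C \<Longrightarrow> (\<And>n. wf_iterm L (s n)) \<Longrightarrow> L \<turnstile> subst_ind s u \<Ztypecolon> subst_form s C"
proof (induction arbitrary: s rule: typing.induct)
  case (t_iapp u A m)
  then have "L \<turnstile> subst_ind s u \<Ztypecolon> All (subst_form (up s) A)" by simp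
  from typing.t_iapp[OF this wf_iterm_subst[OF t_iapp.hyps(2) t_iapp.prems]]
  show ?case by (simp add: subst_form_inst_commute)
next
  case (t_ilam u A)
  then have "L \<turnstile> subst_ind (up s) u \<Ztypecolon> subst_form (up s) A"
    by (simp add: wf_iterm_up)
  moreover have "0 \<notin> fiv_form D" if "(n, D) \<in> fpv (subst_ind (up s) u)" for n D
    using fpv_subst_ind[OF that] t_ilam.hyps by (auto simp: zero_in_fiv_form_up)
  ultimately show ?case by (auto intro: typing.t_ilam)
next
  case (t_ipair A m u)
  then have "L \<turnstile> subst_ind s u \<Ztypecolon> subst_form (inst (subst_iterm s m)) (subst_form (up s) A)"
    by (metis subst_form_inst_commute)
  with t_ipair show ?case
    by (auto intro!: typing.t_ipair wf_form_subst wf_iterm_subst wf_iterm_up)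
next
  case (t_exe u A t C)
  from t_exe have "L \<turnstile> subst_ind s u \<Ztypecolon> Ex (subst_form (up s) A)" by simp
  moreover have "L \<turnstile> subst_ind (up s) t \<Ztypecolon> subst_form shift (subst_form s C)"
    using t_exe by (metis subst_form_up_shift wf_iterm_up)
  moreover have "\<forall>D. (0, D) \<in> fpv (subst_ind (up s) t) \<longrightarrow> D = subst_form (up s) A"
    using t_exe.hyps by (blast dest: fpv_subst_ind)
  moreover have "\<forall>n D. (Suc n, D) \<in> fpv (subst_ind (up s) t) \<longrightarrow> 0 \<notin> fiv_form D"
    using t_exe.hyps by (blast dest: fpv_subst_ind zero_in_fiv_form_up[THEN iffD1])
  ultimately show ?case by (auto intro: typing.t_exe)
next
  case (t_case u A B v C w)
  then have "L \<turnstile> subst_ind s u \<Ztypecolon> Or (subst_form s A) (subst_form s B)" by simp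
  then show ?case
    unfolding subst_ind.simps
    by (rule typing.t_case) (use t_case in \<open>auto dest!: fpv_subst_ind\<close>)
next
  case (t_dummett u C A B v)
  show ?case
    unfolding subst_ind.simps
    by (rule typing.t_dummett[where A = "subst_form s A" and B = "subst_form s B"])
      (use t_dummett in \<open>auto dest!: fpv_subst_ind\<close>)
next
  case (t_lam A u B)
  then show ?case
    by (auto intro!: typing.t_lam wf_form_subst dest!: fpv_subst_ind)
qed (auto intro: typing.intros wf_form_subst atomic_subst)

lemma typing_subst_prf:
  "L \<turnstile> u \<Ztypecolon> C \<Longrightarrow> (\<And>D. (k, D) \<in> fpv u \<Longrightarrow> D = A) \<Longrightarrow> L \<turnstile> t \<Ztypecolon> A
    \<Longrightarrow> L \<turnstile> subst_prf k t u \<Ztypecolon> C"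
proof (induction arbitrary: k t A rule: typing.induct)
  case (t_var C n)
  then show ?case by (auto intro: typing.t_var)
next
  case (t_lam B u C)
  have "L \<turnstile> subst_prf (Suc k) (lift 1 0 t) u \<Ztypecolon> C"
    by (rule t_lam.IH) (use t_lam.prems in \<open>auto intro: typing_lift\<close>)
  with t_lam.hyps show ?case
    by (auto intro!: typing.t_lam dest!: fpv_subst_prf simp: fpv_lift)
next
  case (t_case u B1 B2 v C w)
  have "L \<turnstile> subst_prf k t u \<Ztypecolon> Or B1 B2"
    by (rule t_case.IH) (use t_case.prems in auto)
  moreover have "L \<turnstile> subst_prf (Suc k) (lift 1 0 t) v \<Ztypecolon> C"
    by (rule t_case.IH) (use t_case.prems in \<open>auto intro: typing_lift\<close>)
  moreover have "L \<turnstile> subst_prf (Suc k) (lift 1 0 t) w \<Ztypecolon> C"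
    by (rule t_case.IH) (use t_case.prems in \<open>auto intro: typing_lift\<close>)
  ultimately show ?case using t_case.hyps
    by (auto intro!: typing.t_case dest!: fpv_subst_prf simp: fpv_lift)
next
  case (t_dummett u C B1 B2 v)
  have *: "L \<turnstile> subst_prf (Suc k) (lift 1 0 t) u \<Ztypecolon> C"
    by (rule t_dummett.IH) (use t_dummett.prems in \<open>auto intro: typing_lift\<close>)
  have **: "L \<turnstile> subst_prf (Suc k) (lift 1 0 t) v \<Ztypecolon> C"
    by (rule t_dummett.IH) (use t_dummett.prems in \<open>auto intro: typing_lift\<close>)
  show ?case
    unfolding subst_prf.simps
    by (rule typing.t_dummett[OF * _ **, where A = B1 and B = B2])
      (use t_dummett.hyps in \<open>auto dest!: fpv_subst_prf simp: fpv_lift\<close>)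
next
  case (t_ilam u C)
  have "L \<turnstile> subst_prf k (subst_ind shift t) u \<Ztypecolon> C"
  proof (rule t_ilam.IH)
    \<comment> \<open>\<open>fpv\<close> of \<open>ILam u\<close> sees only shifted types. The
      eigenvariable condition makes \<open>D\<close> shifted, so the assumption about
      \<open>ILam u\<close> applies to this occurrence.\<close>
    fix D assume D: "(k, D) \<in> fpv u"
    with t_ilam.hyps obtain D' where "D = subst_form shift D'"
      by (blast elim: zero_notin_fivE)
    with D t_ilam.prems show "D = subst_form shift A" by auto
  qed (use t_ilam.prems in \<open>auto intro: typing_subst_ind wf_iterm_shift\<close>)
  \<comment> \<open>A free variable coming from the substituted term has a shifted type, since that
    term is itself shifted; the others come from \<open>u\<close>.\<close>
  moreover have "0 \<notin> fiv_form D" if "(n, D) \<in> fpv (subst_prf k (subst_ind shift t) u)" for n D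
    using fpv_subst_prf[OF that] t_ilam.hyps by (auto dest!: fpv_subst_ind)
  ultimately show ?case by (auto intro: typing.t_ilam)
next
  case (t_exe u B v C)
  let ?t = "lift 1 0 (subst_ind shift t)"
  have "L \<turnstile> subst_prf k t u \<Ztypecolon> Ex B"
    by (rule t_exe.IH) (use t_exe.prems in auto)
  moreover have "L \<turnstile> subst_prf (Suc k) ?t v \<Ztypecolon> subst_form shift C"
  proof (rule t_exe.IH)
    fix D assume D: "(Suc k, D) \<in> fpv v"
    with t_exe.hyps obtain D' where "D = subst_form shift D'"
      by (blast elim: zero_notin_fivE)
    with D t_exe.prems show "D = subst_form shift A" by auto
  qed (use t_exe.prems in \<open>auto intro: typing_lift typing_subst_ind wf_iterm_shift\<close>)
  moreover have "\<forall>D. (0, D) \<in> fpv (subst_prf (Suc k) ?t v) \<longrightarrow> D = B"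
    using t_exe.hyps by (auto dest!: fpv_subst_prf simp: fpv_lift)
  moreover have "0 \<notin> fiv_form D" if "(Suc n, D) \<in> fpv (subst_prf (Suc k) ?t v)" for n D
    using fpv_subst_prf[OF that] t_exe.hyps
    by (auto simp: fpv_lift dest!: fpv_subst_ind split: if_splits)
  ultimately show ?case by (auto intro: typing.t_exe)
next
  case (t_pair u B1 v B2)
  show ?case
    unfolding subst_prf.simps
    by (rule typing.t_pair) (rule t_pair.IH[OF _ t_pair.prems(2)], use t_pair.prems in auto)+
next
  case (t_app u B1 B2 v)
  show ?case
    unfolding subst_prf.simps
    by (rule typing.t_app) (rule t_app.IH[OF _ t_app.prems(2)], use t_app.prems in auto)+
qed (auto intro: typing.intros)


section \<open>Stacks and parallel contexts\<close>

lemma elims_Cons: "t \<bullet> (e # \<sigma>) = elim t e \<bullet> \<sigma>"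
  by (simp add: elims_def)

lemma elims_Nil: "t \<bullet> [] = t"
  by (simp add: elims_def)

text \<open>An elimination binds nothing in its principal term, so no side condition inspects
  \<open>t\<close>: only the type found by inversion matters.\<close>

lemma typing_elim_replace:
  "L \<turnstile> elim t e \<Ztypecolon> C \<Longrightarrow> \<exists>E. L \<turnstile> t \<Ztypecolon> E \<and> (\<forall>t'. L \<turnstile> t' \<Ztypecolon> E \<longrightarrow> L \<turnstile> elim t' e \<Ztypecolon> C)"
proof (cases e)
  case (SPrf u)
  assume "L \<turnstile> elim t e \<Ztypecolon> C"
  then obtain A where "L \<turnstile> t \<Ztypecolon> Imp A C" "L \<turnstile> u \<Ztypecolon> A"
    unfolding SPrf by (auto elim: typing_AppE)
  then show ?thesis unfolding SPrf by (auto intro: typing.t_app)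
next
  case (SInd m)
  assume "L \<turnstile> elim t e \<Ztypecolon> C"
  then obtain A where "L \<turnstile> t \<Ztypecolon> All A" "wf_iterm L m" "C = subst_form (inst m) A"
    unfolding SInd by (auto elim: typing_IAppE)
  then show ?thesis unfolding SInd by (auto intro: typing.t_iapp)
next
  case SProj0
  assume "L \<turnstile> elim t e \<Ztypecolon> C"
  then obtain B where "L \<turnstile> t \<Ztypecolon> And C B"
    unfolding SProj0 by (auto elim: typing_Proj0E)
  then show ?thesis unfolding SProj0 by (auto intro: typing.t_proj0)
next
  case SProj1
  assume "L \<turnstile> elim t e \<Ztypecolon> C"
  then obtain A where "L \<turnstile> t \<Ztypecolon> And A C"
    unfolding SProj1 by (auto elim: typing_Proj1E)
  then show ?thesis unfolding SProj1 by (auto intro: typing.t_proj1)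
next
  case (SCase A v B w)
  assume "L \<turnstile> elim t e \<Ztypecolon> C"
  then show ?thesis
    unfolding SCase elim.simps by (elim typing_CaseE) (blast intro: typing.t_case)
next
  case (SEx A v)
  assume "L \<turnstile> elim t e \<Ztypecolon> C"
  then show ?thesis
    unfolding SEx elim.simps by (elim typing_ExEE) (blast intro: typing.t_exe)
qed

lemma typing_elims_replace:
  "L \<turnstile> t \<bullet> \<sigma> \<Ztypecolon> C \<Longrightarrow> \<exists>E. L \<turnstile> t \<Ztypecolon> E \<and> (\<forall>t'. L \<turnstile> t' \<Ztypecolon> E \<longrightarrow> L \<turnstile> t' \<bullet> \<sigma> \<Ztypecolon> C)"
proof (induction \<sigma> arbitrary: t)
  case (Cons e \<sigma>)
  then show ?case unfolding elims_Cons by (meson typing_elim_replace)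
qed (auto simp: elims_Nil)

lemma fpv_elims_mono: "fpv t' \<subseteq> fpv t \<Longrightarrow> fpv (t' \<bullet> \<sigma>) \<subseteq> fpv (t \<bullet> \<sigma>)"
proof (induction \<sigma> arbitrary: t t')
  case (Cons e \<sigma>)
  have "fpv (elim t' e) \<subseteq> fpv (elim t e)" using Cons.prems by (cases e) auto
  with Cons.IH show ?case by (simp add: elims_Cons)
qed (simp add: elims_Nil)

lemma fpv_elims: "fpv t \<subseteq> fpv (t \<bullet> \<sigma>)"
proof (induction \<sigma> arbitrary: t)
  case (Cons e \<sigma>)
  have "fpv t \<subseteq> fpv (elim t e)" by (cases e) auto
  with Cons.IH show ?case by (force simp: elims_Cons)
qed (simp add: elims_Nil)

lemma fiv_elims_mono: "fiv t' \<subseteq> fiv t \<Longrightarrow> fiv (t' \<bullet> \<sigma>) \<subseteq> fiv (t \<bullet> \<sigma>)"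
proof (induction \<sigma> arbitrary: t t')
  case (Cons e \<sigma>)
  have "fiv (elim t' e) \<subseteq> fiv (elim t e)" using Cons.prems by (cases e) auto
  with Cons.IH show ?case by (simp add: elims_Cons)
qed (simp add: elims_Nil)

lemma fiv_elims: "fiv t \<subseteq> fiv (t \<bullet> \<sigma>)"
proof (induction \<sigma> arbitrary: t)
  case (Cons e \<sigma>)
  have "fiv t \<subseteq> fiv (elim t e)" by (cases e) auto
  with Cons.IH show ?case by (force simp: elims_Cons)
qed (simp add: elims_Nil)

section \<open>Parallel contexts\<close>

lemma typing_fillD: "L \<turnstile> fill D p \<Ztypecolon> C \<Longrightarrow> L \<turnstile> p \<Ztypecolon> C"
  by (induction D) (auto elim: typing_ParE)

lemma fpv_fill_hole: "(n + depth D, E) \<in> fpv p \<Longrightarrow> (n, E) \<in> fpv (fill D p)"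
proof (induction D arbitrary: n)
  case (ParL D v)
  with ParL.IH[of "Suc n"] show ?case by simp
next
  case (ParR v D)
  with ParR.IH[of "Suc n"] show ?case by simp
qed simp

text \<open>Here \<open>p\<close> is arbitrary: what the context itself contributes is free in
  \<open>fill D p\<close> whatever fills the hole.\<close>

lemma fpv_fill:
  "(n, E) \<in> fpv (fill D p') \<Longrightarrow> (n, E) \<in> fpv (fill D p) \<or> (n + depth D, E) \<in> fpv p'"
proof (induction D arbitrary: n)
  case (ParL D v)
  with ParL.IH[of "Suc n"] show ?case by auto
next
  case (ParR v D)
  with ParR.IH[of "Suc n"] show ?case by auto
qed simp

lemma fiv_fill: "fiv (fill D p') \<subseteq> fiv (fill D p) \<union> fiv p'"
  by (induction D) auto

lemma fiv_fill_hole: "fiv p \<subseteq> fiv (fill D p)"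
  by (induction D) auto

text \<open>Unlike a stack, a parallel context binds in its hole: the indices below
  \<open>depth D\<close> are captured. If \<open>p'\<close> has these only with types they already
  have in \<open>p\<close>, every Dummett side condition survives.\<close>

lemma typing_fill_replace:
  assumes "L \<turnstile> fill D p \<Ztypecolon> C" and "L \<turnstile> p' \<Ztypecolon> C"
    and "\<And>n E. n < depth D \<Longrightarrow> (n, E) \<in> fpv p' \<Longrightarrow> (n, E) \<in> fpv p"
  shows "L \<turnstile> fill D p' \<Ztypecolon> C"
proof -
  \<comment> \<open>Index \<open>depth D\<close> at the hole is index 0 of the filled context, that
    is, the variable bound by the next parallel operator outside \<open>D\<close>.\<close>
  have bound: "(0, E) \<in> fpv (fill D p)"
    if "(0, E) \<in> fpv (fill D p')" "(depth D, E) \<in> fpv p' \<Longrightarrow> (depth D, E) \<in> fpv p" for D E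
    using fpv_fill[OF that(1)] that(2) fpv_fill_hole[of 0] by auto
  show ?thesis using assms
  proof (induction D)
    case (ParL D v)
    from ParL.prems(1) obtain A B where *:
      "L \<turnstile> fill D p \<Ztypecolon> C" "\<forall>E. (0, E) \<in> fpv (fill D p) \<longrightarrow> E = Imp A B"
      "L \<turnstile> v \<Ztypecolon> C" "\<forall>E. (0, E) \<in> fpv v \<longrightarrow> E = Imp B A"
      by (auto elim: typing_ParE)
    have "L \<turnstile> fill D p' \<Ztypecolon> C"
      by (rule ParL.IH) (use * ParL.prems in auto)
    moreover have "\<forall>E. (0, E) \<in> fpv (fill D p') \<longrightarrow> E = Imp A B"
      using *(2) ParL.prems(3) bound[of _ D] by auto
    ultimately show ?case using * by (auto intro: typing.t_dummett)
  next
    case (ParR v D)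
    from ParR.prems(1) obtain A B where *:
      "L \<turnstile> v \<Ztypecolon> C" "\<forall>E. (0, E) \<in> fpv v \<longrightarrow> E = Imp A B"
      "L \<turnstile> fill D p \<Ztypecolon> C" "\<forall>E. (0, E) \<in> fpv (fill D p) \<longrightarrow> E = Imp B A"
      by (auto elim: typing_ParE)
    have "L \<turnstile> fill D p' \<Ztypecolon> C"
      by (rule ParR.IH) (use * ParR.prems in auto)
    moreover have "\<forall>E. (0, E) \<in> fpv (fill D p') \<longrightarrow> E = Imp B A"
      using *(4) ParR.prems(3) bound[of _ D] by auto
    ultimately show ?case using * by (auto intro: typing.t_dummett)
  qed simp
qed


section \<open>Subject reduction\<close>

text \<open>The inequality is strict because the variable 0 of \<open>v\<close>, its own
  \<open>a\<close>, has been replaced; index \<open>k\<close> can only come from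
  \<open>u\<close>.\<close>

lemma fpv_comm:
  "(n, E) \<in> fpv (comm k B u v) \<Longrightarrow> (n, E) \<in> fpv u \<or> k < n \<and> (n - k, E) \<in> fpv v"
  unfolding comm_def by (drule fpv_subst_prf) (auto simp: fpv_lift split: if_splits)

lemma fiv_comm: "fiv (comm k B u v) \<subseteq> fiv_form B \<union> fiv u \<union> fiv v"
  using fiv_subst_prf[of 0 "Lam B (lift 1 0 u)" "lift (Suc k) 1 v"] by (auto simp: comm_def)

text \<open>The binder of the message is a dummy over a lifted \<open>u\<close>, so it accepts any
  type \<open>B\<close>, and the message gets the type that \<open>a\<close> has in
  \<open>v\<close>.\<close>

lemma typing_comm:
  assumes "wf_form L B" "L \<turnstile> u \<Ztypecolon> A" "L \<turnstile> v \<Ztypecolon> C" "\<forall>D. (0, D) \<in> fpv v \<longrightarrow> D = Imp B A"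
  shows "L \<turnstile> comm k B u v \<Ztypecolon> C"
  unfolding comm_def
proof (rule typing_subst_prf)
  show "L \<turnstile> Lam B (lift 1 0 u) \<Ztypecolon> Imp B A"
    using assms by (auto intro!: typing.t_lam typing_lift simp: fpv_lift)
qed (use assms in \<open>auto intro: typing_lift simp: fpv_lift\<close>)

text \<open>Exchanging \<open>A'\<close> and \<open>B'\<close> exchanges the two sides of the
  Dummett rule, so one statement serves both communication rules. The primed formulas come from the
  typing derivation, the others from the displayed occurrence of \<open>a\<close>.\<close>

lemma communication:
  fixes K :: "('f, 'p) pctx" and \<sigma> :: "('f, 'p) stack" and u v :: "('f, 'p) pterm"
    and A B :: "('f, 'p) form"
  defines "w \<equiv> fill K (App (PVar (depth K) (Imp A B)) u \<bullet> \<sigma>)"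
    and "w' \<equiv> fill K (comm (depth K) B u v)"
  assumes w: "L \<turnstile> w \<Ztypecolon> C" "\<forall>D. (0, D) \<in> fpv w \<longrightarrow> D = Imp A' B'"
    and v: "L \<turnstile> v \<Ztypecolon> C" "\<forall>D. (0, D) \<in> fpv v \<longrightarrow> D = Imp B' A'"
  shows "L \<turnstile> w' \<Ztypecolon> C"
    and "\<forall>D. (0, D) \<in> fpv w' \<longrightarrow> D = Imp A' B'"
    and "(n, E) \<in> fpv w' \<Longrightarrow> (n, E) \<in> fpv w \<or> (n, E) \<in> fpv v"
    and "fiv w' \<subseteq> fiv w \<union> fiv v"
proof -
  let ?a = "PVar (depth K) (Imp A B) :: ('f, 'p) pterm"
  let ?p = "App ?a u \<bullet> \<sigma>"
  have app: "fpv (App ?a u) \<subseteq> fpv ?p" by (rule fpv_elims)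
  \<comment> \<open>The displayed \<open>a\<close> has index \<open>depth K\<close> at the hole,
    hence index 0 in \<open>w\<close>, and the side condition identifies its annotation with
    \<open>Imp A' B'\<close>.\<close>
  then have "(0, Imp A B) \<in> fpv w"
    unfolding w_def by (intro fpv_fill_hole) auto
  with w(2) have AB: "A' = A" "B' = B" by auto
  from w(1) have p: "L \<turnstile> ?p \<Ztypecolon> C" unfolding w_def by (rule typing_fillD)
  then obtain T where "L \<turnstile> App ?a u \<Ztypecolon> T" by (blast dest: typing_elims_replace)
  then have u: "L \<turnstile> u \<Ztypecolon> A" "wf_form L B"
    by (auto elim!: typing_AppE typing_PVarE)
  \<comment> \<open>The stack is discarded with the old process. The replacement still has type
    \<open>C\<close>, since it is an instance of \<open>v\<close>, and all parallel processes share
    one type.\<close>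
  have comm: "L \<turnstile> comm (depth K) B u v \<Ztypecolon> C"
    using u v AB by (auto intro!: typing_comm)
  show "L \<turnstile> w' \<Ztypecolon> C"
    unfolding w'_def
  proof (rule typing_fill_replace)
    show "L \<turnstile> fill K ?p \<Ztypecolon> C" using w(1) by (simp add: w_def)
    show "(n, E) \<in> fpv ?p" if "n < depth K" "(n, E) \<in> fpv (comm (depth K) B u v)" for n E
      using fpv_comm[OF that(2)] that(1) app by auto
  qed (rule comm)
  \<comment> \<open>The conjunct \<open>0 < n\<close> keeps the \<open>a\<close> of
    \<open>v\<close>, which has the opposite type \<open>Imp B' A'\<close>, out of
    \<open>w'\<close>.\<close>
  have fpv_w': "(n, E) \<in> fpv w \<or> 0 < n \<and> (n, E) \<in> fpv v" if "(n, E) \<in> fpv w'" for n E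
  proof (cases "(n, E) \<in> fpv w")
    case False
    with that have "(n + depth K, E) \<in> fpv (comm (depth K) B u v)"
      unfolding w_def w'_def by (blast dest: fpv_fill)
    then have "(n + depth K, E) \<in> fpv u \<or> 0 < n \<and> (n, E) \<in> fpv v"
      by (auto dest: fpv_comm)
    \<comment> \<open>\<open>u\<close> already stood at this hole, so any such variable of it would
      be free in \<open>w\<close>.\<close>
    moreover have "(n + depth K, E) \<notin> fpv u"
      using False app unfolding w_def by (auto dest: fpv_fill_hole)
    ultimately show ?thesis by simp
  qed simp
  then show "\<forall>D. (0, D) \<in> fpv w' \<longrightarrow> D = Imp A' B'" using w(2) by blast
  show "(n, E) \<in> fpv w' \<Longrightarrow> (n, E) \<in> fpv w \<or> (n, E) \<in> fpv v" by (blast dest: fpv_w')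
  have "fiv_form B \<union> fiv u \<subseteq> fiv (App ?a u)" by auto
  also have "\<dots> \<subseteq> fiv ?p" by (rule fiv_elims)
  also have "\<dots> \<subseteq> fiv w" unfolding w_def by (rule fiv_fill_hole)
  finally show "fiv w' \<subseteq> fiv w \<union> fiv v"
    using fiv_fill[of K "comm (depth K) B u v" ?p] fiv_comm[of "depth K" B u v]
    unfolding w_def w'_def by blast
qed

lemma fpv_subst_prf_0:
  "fpv (subst_prf 0 t u) \<subseteq> fpv t \<union> {(n, D). (Suc n, D) \<in> fpv u}"
  using fpv_subst_prf[where k = 0] by fastforce

text \<open>Under the eigenvariable condition the types are shifted formulas, on which
  \<open>inst m\<close> merely undoes the shift.\<close>

lemma fpv_subst_ind_inst:
  assumes "\<And>D. (n, D) \<in> fpv u \<Longrightarrow> 0 \<notin> fiv_form D" and "(n, D) \<in> fpv (subst_ind (inst m) u)"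
  shows "(n, subst_form shift D) \<in> fpv u"
proof -
  from fpv_subst_ind[OF assms(2)] obtain E where E: "D = subst_form (inst m) E" "(n, E) \<in> fpv u"
    by blast
  with assms(1) obtain E' where "E = subst_form shift E'" by (blast elim: zero_notin_fivE)
  with E show ?thesis by simp
qed

section \<open>Basic reductions\<close>

lemma basic_typing: "r \<mapsto> r' \<Longrightarrow> L \<turnstile> r \<Ztypecolon> C \<Longrightarrow> L \<turnstile> r' \<Ztypecolon> C"
proof (induction rule: basic.induct)
  case (b_beta A u t)
  then show ?case by (auto elim!: typing_elims intro: typing_subst_prf)
next
  case (b_ibeta u m)
  then show ?case by (auto elim!: typing_elims intro!: typing_subst_ind wf_iterm_inst)
next
  case (b_case0 u A v B w)
  then show ?case by (auto elim!: typing_elims intro: typing_subst_prf)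
next
  case (b_case1 u A v B w)
  then show ?case by (auto elim!: typing_elims intro: typing_subst_prf)
next
  case (b_exe m u A v)
  then have *: "wf_iterm L m" "L \<turnstile> u \<Ztypecolon> subst_form (inst m) A" "L \<turnstile> v \<Ztypecolon> subst_form shift C"
    "\<forall>D. (0, D) \<in> fpv v \<longrightarrow> D = A"
    by (auto elim!: typing_elims)
  have "L \<turnstile> subst_ind (inst m) v \<Ztypecolon> C"
    using typing_subst_ind[OF *(3), of "inst m"] *(1) by (simp add: wf_iterm_inst)
  \<comment> \<open>After instantiation the variable \<open>x\<close> carries
    \<open>A[m/\<alpha>]\<close>, which is the type of \<open>u\<close>.\<close>
  then show ?case
    by (rule typing_subst_prf) (use * in \<open>auto dest: fpv_subst_ind\<close>)
next
  case (b_par_app u v w)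
  then show ?case
    by (elim typing_elims) (rule typing.t_dummett, auto intro: typing.t_app typing_lift simp: fpv_lift)
next
  case (b_par_iapp u v m)
  then show ?case
    by (elim typing_elims) (rule typing.t_dummett, auto intro: typing.t_iapp)
next
  case (b_par_proj0 u v)
  then show ?case
    by (elim typing_elims) (rule typing.t_dummett, auto intro: typing.t_proj0)
next
  case (b_par_proj1 u v)
  then show ?case
    by (elim typing_elims) (rule typing.t_dummett, auto intro: typing.t_proj1)
next
  case (b_par_case u v A w1 B w2)
  \<comment> \<open>\<open>lift 1 1\<close> keeps 0 as the variable of each branch and frees index 1
    for the \<open>a\<close> whose scope now includes the branches.\<close>
  then show ?case
    by (elim typing_elims)
      (rule typing.t_dummett, auto intro!: typing.t_case intro: typing_lift simp: fpv_lift)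
next
  case (b_par_exe u v A w)
  then show ?case
    by (elim typing_elims)
      (rule typing.t_dummett,
       auto intro!: typing.t_exe intro: typing_lift simp: fpv_lift Suc_le_eq gr0_conv_Suc)
next
  case (b_comm_left K A B u \<sigma> v)
  then show ?case
    by (elim typing_ParE) (rule typing.t_dummett, auto dest: communication(1,2))
next
  case (b_comm_right v K A B u \<sigma>)
  then show ?case
    by (elim typing_ParE) (rule typing.t_dummett, auto dest: communication(1,2))
qed (auto elim!: typing_elims)

text \<open>Typing matters for quantifier redexes: in an ill-typed one, \<open>fpv\<close> could
  miss a variable whose type contains the bound \<alpha>, and contraction would release it.\<close>

lemma basic_fpv: "r \<mapsto> r' \<Longrightarrow> L \<turnstile> r \<Ztypecolon> C \<Longrightarrow> fpv r' \<subseteq> fpv r"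
proof (induction rule: basic.induct)
  case (b_beta A u t)
  show ?case using fpv_subst_prf_0[of t u] by auto
next
  case (b_ibeta u m)
  then show ?case by (auto elim!: typing_elims intro: fpv_subst_ind_inst)
next
  case (b_case0 u A v B w)
  show ?case using fpv_subst_prf_0[of u v] by auto
next
  case (b_case1 u A v B w)
  show ?case using fpv_subst_prf_0[of u w] by auto
next
  case (b_exe m u A v)
  then have "\<forall>n D. (Suc n, D) \<in> fpv v \<longrightarrow> 0 \<notin> fiv_form D"
    by (auto elim!: typing_elims)
  then have "(n, D) \<in> fpv (ExE (IPair m u) A v)"
    if "(n, D) \<in> fpv (subst_prf 0 u (subst_ind (inst m) v))" for n D
    using that fpv_subst_prf_0[of u "subst_ind (inst m) v"]
      fpv_subst_ind_inst[of "Suc n" v D m] by auto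
  then show ?case by auto
next
  case (b_comm_left K A B u \<sigma> v)
  then show ?case by (elim typing_ParE) (auto dest: communication(3))
next
  case (b_comm_right v K A B u \<sigma>)
  then show ?case by (elim typing_ParE) (auto dest: communication(3))
qed (auto simp: fpv_lift)

lemma basic_fiv: "r \<mapsto> r' \<Longrightarrow> L \<turnstile> r \<Ztypecolon> C \<Longrightarrow> fiv r' \<subseteq> fiv r"
proof (induction rule: basic.induct)
  case (b_beta A u t)
  show ?case using fiv_subst_prf[of 0 t u] by auto
next
  case (b_ibeta u m)
  show ?case using fiv_subst_ind_inst[of m u] by auto
next
  case (b_case0 u A v B w)
  show ?case using fiv_subst_prf[of 0 u v] by auto
next
  case (b_case1 u A v B w)
  show ?case using fiv_subst_prf[of 0 u w] by auto
next
  case (b_exe m u A v)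
  show ?case
    using fiv_subst_prf[of 0 u "subst_ind (inst m) v"] fiv_subst_ind_inst[of m v] by auto
next
  case (b_comm_left K A B u \<sigma> v)
  then show ?case by (elim typing_ParE) (auto dest: communication(4))
next
  case (b_comm_right v K A B u \<sigma>)
  then show ?case by (elim typing_ParE) (auto dest: communication(4))
qed auto

section \<open>Head reduction\<close>

lemma head_redex_elims: "head_redex p r \<sigma> \<Longrightarrow> p = r \<bullet> \<sigma>"
  by (induction rule: head_redex.induct) (auto simp: elims_Nil)

theorem theorem2p7:
  fixes L :: "('f, 'p) language" and t u :: "('f, 'p) pterm" and C :: "('f, 'p) form"
  assumes "L \<turnstile> t \<Ztypecolon> C" and "t \<succ> u"
  shows "L \<turnstile> u \<Ztypecolon> C \<and> fpv u \<subseteq> fpv t \<and> fiv u \<subseteq> fiv t"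
proof -
  from assms(2) obtain D r \<sigma> r' where t: "t = fill D (r \<bullet> \<sigma>)" and u: "u = fill D (r' \<bullet> \<sigma>)"
    and step: "r \<mapsto> r'"
    unfolding head_red_def by (blast dest: head_redex_elims)
  from assms(1) have "L \<turnstile> r \<bullet> \<sigma> \<Ztypecolon> C" unfolding t by (rule typing_fillD)
  then obtain E where r: "L \<turnstile> r \<Ztypecolon> E" and repl: "\<And>t'. L \<turnstile> t' \<Ztypecolon> E \<Longrightarrow> L \<turnstile> t' \<bullet> \<sigma> \<Ztypecolon> C"
    by (blast dest: typing_elims_replace)
  have typed: "L \<turnstile> r' \<bullet> \<sigma> \<Ztypecolon> C" using basic_typing[OF step r] by (rule repl)
  have fpv: "fpv (r' \<bullet> \<sigma>) \<subseteq> fpv (r \<bullet> \<sigma>)" using basic_fpv[OF step r] by (rule fpv_elims_mono)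
  have fiv: "fiv (r' \<bullet> \<sigma>) \<subseteq> fiv (r \<bullet> \<sigma>)" using basic_fiv[OF step r] by (rule fiv_elims_mono)
  \<comment> \<open>The condition on the variables captured by \<open>D\<close> follows from the
    inclusion of free proof variables at the hole.\<close>
  have "L \<turnstile> u \<Ztypecolon> C"
    unfolding u by (rule typing_fill_replace[OF assms(1)[unfolded t] typed]) (use fpv in blast)
  moreover have "fpv u \<subseteq> fpv t"
    unfolding t u using fpv by (auto dest!: fpv_fill[where p = "r \<bullet> \<sigma>"] intro: fpv_fill_hole)
  moreover have "fiv u \<subseteq> fiv t"
    unfolding t u using fiv fiv_fill[of D "r' \<bullet> \<sigma>" "r \<bullet> \<sigma>"] fiv_fill_hole[of "r \<bullet> \<sigma>" D] by blast
  ultimately show ?thesis by simp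
qed

end
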